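(* Let $f$ be randomly chosen from $\mathcal F$ and let $\beta=\beta(f)=\mathrm{tr}^2(A)-4$, where $A$ is the matrix representing $f$. Then the random variable $\beta$ takes values in $[-4,\infty)$ and has probability density function $$G[\beta]=\frac{1}{\pi^2(\beta+4)}\,\log\left|\frac{\sqrt{\beta+4}+2}{\sqrt{\beta+4}-2}\right|,\qquad \beta\ge -4 .$$
   Context: $\mathbb S$ is the unit circle in $\mathbb C$. $\mathcal F$ is the group of matrices $A=\pm\begin{pmatrix} a & c\\ \bar c & \bar a\end{pmatrix}\in PSL(2,\mathbb C)$ with $a,c\in\mathbb C$, $|a|^2-|c|^2=1$, identified with the group of Möbius transformations $f(z)=\frac{az+c}{\bar c z+\bar a}$ preserving $\mathbb S$ and the unit disk. A random element of $\mathcal F$ is obtained by choosing, independently, $a/|a|$ and $c/|c|$ uniformly on $\mathbb S$ with respect to arclength, and $|a|\ge 1$ such that $2\arcsin(1/|a|)$ is uniformly distributed in $[0,\pi]$, with $|c|=\sqrt{|a|^2-1}$. *)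

theory Defs
  imports "HOL-Probability.Probability" "HOL-Algebra.Coset"
begin

definition SL2C :: "(complex^2^2) monoid" where
  "SL2C = \<lparr>carrier = {A. det A = 1}, mult = (\<lambda>A B. A ** B), one = mat 1\<rparr>"

definition PSL2C :: "(complex^2^2) set monoid" where
  "PSL2C = SL2C Mod {mat 1, - mat 1}"

definition disk_matrix :: "complex \<Rightarrow> complex \<Rightarrow> complex^2^2" where
  "disk_matrix a c = vector [vector [a, c], vector [cnj c, cnj a]]"

text \<open>The element of \<open>PSL2C\<close> represented by \<open>disk_matrix a c\<close>, i.e. the coset
  \<open>{A, -A}\<close> for \<open>A = disk_matrix a c\<close>.\<close>

definition disk_elem :: "complex \<Rightarrow> complex \<Rightarrow> (complex^2^2) set" where
  "disk_elem a c = {mat 1, - mat 1} #>\<^bsub>SL2C\<^esub> disk_matrix a c"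

definition disk_group :: "(complex^2^2) set set" where
  "disk_group = {disk_elem a c | a c. (norm a)\<^sup>2 - (norm c)\<^sup>2 = 1}"

text \<open>Both representatives of an element of \<open>PSL2C\<close> have the same squared trace; see
  \<open>beta_eq\<close> below.\<close>

definition beta :: "(complex^2^2) set \<Rightarrow> complex" where
  "beta f = (THE b. \<forall>A\<in>f. b = (trace A)\<^sup>2 - 4)"

text \<open>Arclength on the unit circle, as a measure on the plane: \<open>cis\<close> is the unit speed
  parametrisation.\<close>

definition circle_arclength :: "complex measure" where
  "circle_arclength = distr (restrict_space lborel {0..<2 * pi}) borel cis"

text \<open>
  \<open>sgn z = z / norm z\<close>, with \<open>sgn 0 = 0\<close>. The value \<open>c = 0\<close>
  occurs only if \<open>norm a = 1\<close>, hence with probability 0. The third variable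
  \<open>norm a\<close> is coerced into the complex numbers because \<open>indep_vars\<close> asks for
  a common value type; the coercion does not change the generated sigma-algebra.
\<close>

definition random_disk_element :: "'w measure \<Rightarrow> ('w \<Rightarrow> (complex^2^2) set) \<Rightarrow> bool" where
  "random_disk_element M f \<longleftrightarrow>
     (\<exists>a c. a \<in> borel_measurable M \<and> c \<in> borel_measurable M \<and>
        (\<forall>\<omega>\<in>space M. (norm (a \<omega>))\<^sup>2 - (norm (c \<omega>))\<^sup>2 = 1 \<and> f \<omega> = disk_elem (a \<omega>) (c \<omega>)) \<and>
        prob_space.indep_vars M (\<lambda>_. borel)
          (\<lambda>i \<omega>. [sgn (a \<omega>), sgn (c \<omega>), complex_of_real (norm (a \<omega>))] ! i) {0, 1, 2} \<and>
        distr M borel (\<lambda>\<omega>. sgn (a \<omega>)) = uniform_measure circle_arclength (sphere 0 1) \<and>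
        distr M borel (\<lambda>\<omega>. sgn (c \<omega>)) = uniform_measure circle_arclength (sphere 0 1) \<and>
        distr M borel (\<lambda>\<omega>. 2 * arcsin (1 / norm (a \<omega>))) = uniform_measure lborel {0..pi})"

lemma SL2C_simps [simp]:
  "carrier SL2C = {A. det A = 1}" "A \<otimes>\<^bsub>SL2C\<^esub> B = A ** B" "\<one>\<^bsub>SL2C\<^esub> = mat 1"
  by (simp_all add: SL2C_def)

lemma matrix_mul_uminus:
  fixes A B :: "'a::comm_ring_1^'n^'n"
  shows "(- A) ** B = - (A ** B)" "A ** (- B) = - (A ** B)"
  by (simp_all add: matrix_matrix_mult_def vec_eq_iff sum_negf)

lemma det_uminus2: "det (- A) = det (A :: complex^2^2)"
  by (simp add: det_2)

lemma group_SL2C: "group SL2C"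
proof (rule groupI)
  fix A assume "A \<in> carrier SL2C"
  then have d: "det A = 1" by simp
  then obtain B where B: "A ** B = mat 1" "B ** A = mat 1"
    using invertible_det_nz[of A] by (auto simp: invertible_def)
  have "det B = 1" using arg_cong[OF B(1), of det] d by (simp add: det_mul)
  then show "\<exists>B\<in>carrier SL2C. B \<otimes>\<^bsub>SL2C\<^esub> A = \<one>\<^bsub>SL2C\<^esub>" using B by auto
qed (auto simp: det_mul matrix_mul_assoc)

lemma normal_pm_one: "{mat 1, - mat 1} \<lhd> SL2C"
proof -
  interpret group SL2C by (rule group_SL2C)
  have sub: "subgroup {mat 1, - mat 1} SL2C"
  proof (rule subgroupI)
    fix A assume "A \<in> {mat 1, - mat 1 :: complex^2^2}"
    moreover have "inv\<^bsub>SL2C\<^esub> (mat 1) = mat 1" using inv_one by simp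
    moreover have "inv\<^bsub>SL2C\<^esub> (- mat 1) = - mat 1"
      by (rule inv_equality) (auto simp: matrix_mul_uminus det_uminus2)
    ultimately show "inv\<^bsub>SL2C\<^esub> A \<in> {mat 1, - mat 1}" by auto
  qed (auto simp: det_uminus2 matrix_mul_uminus)
  show ?thesis
    by (rule normalI[OF sub]) (auto simp: r_coset_def l_coset_def matrix_mul_uminus)
qed

lemma group_PSL2C: "group PSL2C"
  unfolding PSL2C_def by (rule normal.factorgroup_is_group[OF normal_pm_one])

lemma disk_elem_eq: "disk_elem a c = {disk_matrix a c, - disk_matrix a c}"
  by (auto simp: disk_elem_def r_coset_def matrix_mul_uminus)

lemma det_disk_matrix: "det (disk_matrix a c) = of_real ((norm a)\<^sup>2 - (norm c)\<^sup>2)"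
  unfolding of_real_diff complex_norm_square by (simp add: disk_matrix_def det_2)

lemma disk_matrix_mult:
  "disk_matrix a c ** disk_matrix a' c' = disk_matrix (a * a' + c * cnj c') (a * c' + c * cnj a')"
  by (simp add: disk_matrix_def vec_eq_iff forall_2 matrix_matrix_mult_def sum_2)

lemma subgroup_disk_group: "subgroup disk_group PSL2C"
proof -
  interpret S: group SL2C by (rule group_SL2C)
  interpret N: normal "{mat 1, - mat 1}" SL2C by (rule normal_pm_one)
  interpret P: group PSL2C by (rule group_PSL2C)
  have det: "det (disk_matrix a c) = 1" if "(norm a)\<^sup>2 - (norm c)\<^sup>2 = 1" for a c
    unfolding det_disk_matrix that by simp
  have car: "disk_elem a c \<in> carrier PSL2C" if "(norm a)\<^sup>2 - (norm c)\<^sup>2 = 1" for a c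
  proof -
    have "disk_matrix a c \<in> carrier SL2C" unfolding SL2C_simps using det[OF that] by simp
    then show ?thesis unfolding PSL2C_def FactGroup_def RCOSETS_def disk_elem_def by auto
  qed
  have mult: "disk_elem a c \<otimes>\<^bsub>PSL2C\<^esub> disk_elem a' c' =
      disk_elem (a * a' + c * cnj c') (a * c' + c * cnj a')"
    if "(norm a)\<^sup>2 - (norm c)\<^sup>2 = 1" "(norm a')\<^sup>2 - (norm c')\<^sup>2 = 1" for a c a' c'
    using det[OF that(1)] det[OF that(2)] N.rcos_sum[of "disk_matrix a c" "disk_matrix a' c'"]
    by (simp add: PSL2C_def FactGroup_def disk_elem_def disk_matrix_mult)
  have one: "\<one>\<^bsub>PSL2C\<^esub> = disk_elem 1 0"
  proof -
    have "disk_matrix 1 0 = mat 1" by (simp add: disk_matrix_def vec_eq_iff forall_2 mat_def)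
    then show ?thesis by (simp add: PSL2C_def FactGroup_def disk_elem_eq)
  qed
  have norm: "(norm (a * a' + c * cnj c'))\<^sup>2 - (norm (a * c' + c * cnj a'))\<^sup>2 = 1"
    if "(norm a)\<^sup>2 - (norm c)\<^sup>2 = 1" "(norm a')\<^sup>2 - (norm c')\<^sup>2 = 1" for a c a' c'
  proof -
    have "det (disk_matrix a c ** disk_matrix a' c') = 1"
      using det[OF that(1)] det[OF that(2)] by (simp add: det_mul)
    then show ?thesis
      unfolding disk_matrix_mult det_disk_matrix by (simp only: of_real_eq_1_iff)
  qed
  show ?thesis
  proof (rule P.subgroupI)
    show "disk_group \<subseteq> carrier PSL2C" using car by (auto simp: disk_group_def)
    have "disk_elem 1 0 \<in> disk_group" unfolding disk_group_def
      by (intro CollectI exI[of _ 1] exI[of _ 0]) simp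
    then show "disk_group \<noteq> {}" by auto
  next
    fix f assume "f \<in> disk_group"
    then obtain a c where f: "f = disk_elem a c" "(norm a)\<^sup>2 - (norm c)\<^sup>2 = 1"
      by (auto simp: disk_group_def)
    have n: "(norm (cnj a))\<^sup>2 - (norm (- c))\<^sup>2 = 1" using f by simp
    have "cnj a * a - c * cnj c = of_real ((norm a)\<^sup>2 - (norm c)\<^sup>2)"
      unfolding of_real_diff complex_norm_square by (simp add: mult.commute)
    then have "disk_elem (cnj a) (- c) \<otimes>\<^bsub>PSL2C\<^esub> f = \<one>\<^bsub>PSL2C\<^esub>"
      using mult[OF n f(2)] f by (simp add: one mult.commute)
    then have "inv\<^bsub>PSL2C\<^esub> f = disk_elem (cnj a) (- c)"
      using P.inv_equality car[OF n] car[OF f(2)] f(1) by blast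
    then show "inv\<^bsub>PSL2C\<^esub> f \<in> disk_group" using n unfolding disk_group_def by blast
  next
    fix f g assume "f \<in> disk_group" "g \<in> disk_group"
    then obtain a c a' c' where "f = disk_elem a c" "g = disk_elem a' c'"
      and n: "(norm a)\<^sup>2 - (norm c)\<^sup>2 = 1" "(norm a')\<^sup>2 - (norm c')\<^sup>2 = 1"
      unfolding disk_group_def by blast
    then have "f \<otimes>\<^bsub>PSL2C\<^esub> g = disk_elem (a * a' + c * cnj c') (a * c' + c * cnj a')"
      using mult by simp
    then show "f \<otimes>\<^bsub>PSL2C\<^esub> g \<in> disk_group"
      using norm[OF n] unfolding disk_group_def by blast
  qed
qed

lemma beta_eq:
  assumes "f \<in> carrier PSL2C" "A \<in> f"
  shows "beta f = (trace A)\<^sup>2 - 4"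
proof -
  obtain B where "f = {B, - B}"
    using assms(1)
    by (auto simp: PSL2C_def FactGroup_def RCOSETS_def r_coset_def matrix_mul_uminus)
  moreover have "trace (- B) = - trace B" by (simp add: trace_def sum_negf)
  ultimately have "\<forall>B\<in>f. (trace B)\<^sup>2 = (trace A)\<^sup>2" using assms(2) by auto
  then have "\<forall>B\<in>f. (trace A)\<^sup>2 - 4 = (trace B)\<^sup>2 - 4" by simp
  then show ?thesis
    unfolding beta_def by (rule the_equality) (use assms(2) in blast)
qed

lemma random_disk_element_in_group:
  assumes "random_disk_element M f" "\<omega> \<in> space M"
  shows "f \<omega> \<in> disk_group"
  using assms unfolding random_disk_element_def disk_group_def by blast

end

theory Submission imports Defs begin

text \<open>
  For \<open>f\<close> represented by \<open>disk_matrix a c\<close> the trace is \<open>2 * Re a\<close>, so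
  \<open>beta f = 4 * (Re a)\<^sup>2 - 4\<close>: it is real and at least \<open>-4\<close> (lemma \<open>beta_disk_elem\<close>).

  Write \<open>a = norm a * cis \<theta>\<close> and \<open>1 / norm a = sin (\<phi> / 2)\<close> with \<open>\<phi>\<close> uniform in
  \<open>{0..pi}\<close>. Then \<open>(Re a)\<^sup>2 = U / V\<close> with \<open>U = (cos \<theta>)\<^sup>2\<close> and \<open>V = (sin (\<phi> / 2))\<^sup>2\<close>.
  These variables are independent, and both have the arcsine law with density
  \<open>1 / (pi * sqrt (x * (1 - x)))\<close> on the unit interval: for \<open>V\<close> by the substitution
  \<open>x = (sin \<psi>)\<^sup>2\<close> on a quarter circle, for \<open>U\<close> because all four quadrants contribute equally
  (lemmas \<open>nn_integral_uniform_sin_half_squared\<close> and \<open>nn_integral_uniform_circle_Re_squared\<close>).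

  The quotient of two independent variables with densities \<open>p\<close> and \<open>q\<close> has at \<open>w\<close> the density
  \<open>\<integral> \<bar>v\<bar> * p (w * v) * q v dv\<close> (lemma \<open>distributed_divide\<close>). For two arcsine laws and \<open>w > 0\<close>
  this is \<open>1 / (pi\<^sup>2 * sqrt w)\<close> times the integral of \<open>1 / (sqrt (1 - v) * sqrt (1 - w * v))\<close> over
  \<open>0 < v < min 1 (1 / w)\<close>, and the antiderivative
  \<open>- (2 / sqrt w) * ln (sqrt w * sqrt (1 - v) + sqrt (1 - w * v))\<close> evaluates it to
  \<open>1 / (pi\<^sup>2 * w) * ln \<bar>(1 + sqrt w) / (1 - sqrt w)\<bar>\<close> (lemma \<open>nn_integral_arcsine_quotient\<close>).
  The affine change of variable \<open>b = 4 * w - 4\<close> turns this into the density of \<open>beta\<close>.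
\<close>

section \<open>Densities\<close>

lemma distributed_lborelI:
  assumes [measurable]: "X \<in> borel_measurable M" "p \<in> borel_measurable borel"
    and eq: "\<And>A. A \<in> sets borel \<Longrightarrow>
      (\<integral>\<^sup>+\<omega>. indicator A (X \<omega>) \<partial>M) = emeasure (density lborel p) A"
  shows "distributed M lborel X p"
proof -
  have "distr M lborel X = density lborel p"
  proof (rule measure_eqI)
    fix A assume "A \<in> sets (distr M lborel X)"
    then have A[measurable]: "A \<in> sets borel" by simp
    have "emeasure (distr M lborel X) A = (\<integral>\<^sup>+x. indicator A x \<partial>distr M lborel X)"
      by simp
    also have "\<dots> = (\<integral>\<^sup>+\<omega>. indicator A (X \<omega>) \<partial>M)"
      by (rule nn_integral_distr) measurable
    finally show "emeasure (distr M lborel X) A = emeasure (density lborel p) A"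
      by (simp add: eq[OF A])
  qed simp
  then show ?thesis by (simp add: distributed_def)
qed

text \<open>The multiplicative counterpart of the convolution formula for sums: for a fixed value
  \<open>y\<close> of the denominator, substitute \<open>x = r * y\<close> in the integral over the numerator, which brings
  in the Jacobian \<open>\<bar>y\<bar>\<close>. The value \<open>y = 0\<close> is negligible because \<open>Y\<close> has a density.\<close>

lemma (in prob_space) distributed_divide:
  fixes X Y :: "'a \<Rightarrow> real" and p q :: "real \<Rightarrow> ennreal"
  assumes indep: "indep_var borel X borel Y"
    and X: "distributed M lborel X p" and Y: "distributed M lborel Y q"
  shows "distributed M lborel (\<lambda>\<omega>. X \<omega> / Y \<omega>)
    (\<lambda>r. \<integral>\<^sup>+y. ennreal \<bar>y\<bar> * p (r * y) * q y \<partial>lborel)"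
proof -
  have [measurable]: "p \<in> borel_measurable borel" "q \<in> borel_measurable borel"
    using distributed_borel_measurable[OF X] distributed_borel_measurable[OF Y] by simp_all
  have [measurable]: "X \<in> borel_measurable M" "Y \<in> borel_measurable M"
    using distributed_measurable[OF X] distributed_measurable[OF Y] by simp_all
  have "indep_var lborel X lborel Y"
    using indep by (simp add: indep_var_eq)
  then have joint: "distributed M (lborel \<Otimes>\<^sub>M lborel) (\<lambda>\<omega>. (X \<omega>, Y \<omega>)) (\<lambda>(x, y). p x * q y)"
    by (intro distributed_joint_indep X Y) unfold_locales
  have "distr M lborel (\<lambda>\<omega>. X \<omega> / Y \<omega>)
    = density lborel (\<lambda>r. \<integral>\<^sup>+y. ennreal \<bar>y\<bar> * p (r * y) * q y \<partial>lborel)"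
  proof (rule measure_eqI)
    fix A :: "real set"
    assume "A \<in> sets (distr M lborel (\<lambda>\<omega>. X \<omega> / Y \<omega>))"
    then have [measurable]: "A \<in> sets borel" by simp
    have "emeasure (distr M lborel (\<lambda>\<omega>. X \<omega> / Y \<omega>)) A
        = (\<integral>\<^sup>+r. indicator A r \<partial>distr M lborel (\<lambda>\<omega>. X \<omega> / Y \<omega>))"
      by simp
    also have "\<dots> = (\<integral>\<^sup>+\<omega>. (\<lambda>(x, y). indicator A (x / y)) (X \<omega>, Y \<omega>) \<partial>M)"
      by (subst nn_integral_distr) auto
    also have "\<dots> = (\<integral>\<^sup>+z. (\<lambda>(x, y). p x * q y) z * (\<lambda>(x, y). indicator A (x / y)) z
        \<partial>(lborel \<Otimes>\<^sub>M lborel))"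
      by (rule distributed_nn_integral[OF joint, symmetric]) measurable
    also have "\<dots> = (\<integral>\<^sup>+y. \<integral>\<^sup>+x. p x * q y * indicator A (x / y) \<partial>lborel \<partial>lborel)"
      by (subst lborel_pair.nn_integral_snd[symmetric]) (auto simp: case_prod_beta)
    also have "\<dots> = (\<integral>\<^sup>+y. \<integral>\<^sup>+r. ennreal \<bar>y\<bar> * p (r * y) * q y * indicator A r \<partial>lborel \<partial>lborel)"
    proof (rule nn_integral_cong_AE)
      have "AE y in lborel. y \<noteq> (0::real)"
        by (rule AE_lborel_singleton)
      then show "AE y in lborel. (\<integral>\<^sup>+x. p x * q y * indicator A (x / y) \<partial>lborel)
          = (\<integral>\<^sup>+r. ennreal \<bar>y\<bar> * p (r * y) * q y * indicator A r \<partial>lborel)"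
      proof eventually_elim
        case (elim y)
        have "(\<integral>\<^sup>+x. p x * q y * indicator A (x / y) \<partial>lborel)
          = ennreal \<bar>y\<bar> * (\<integral>\<^sup>+r. p (0 + y * r) * q y * indicator A ((0 + y * r) / y) \<partial>lborel)"
          using elim by (intro nn_integral_real_affine) measurable
        also have "\<dots> = (\<integral>\<^sup>+r. ennreal \<bar>y\<bar> * p (r * y) * q y * indicator A r \<partial>lborel)"
          using elim by (subst nn_integral_cmult[symmetric]) (auto simp: mult_ac)
        finally show ?case .
      qed
    qed
    also have "\<dots> = (\<integral>\<^sup>+r. \<integral>\<^sup>+y. ennreal \<bar>y\<bar> * p (r * y) * q y * indicator A r \<partial>lborel \<partial>lborel)"
      by (rule lborel_pair.Fubini') measurable
    also have "\<dots> = emeasure (density lborel (\<lambda>r. \<integral>\<^sup>+y. ennreal \<bar>y\<bar> * p (r * y) * q y \<partial>lborel)) A"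
      by (simp add: emeasure_density nn_integral_multc)
    finally show "emeasure (distr M lborel (\<lambda>\<omega>. X \<omega> / Y \<omega>)) A = \<dots>" .
  qed simp
  then show ?thesis
    unfolding distributed_def by simp
qed

section \<open>The arcsine law\<close>

definition arcsine_density :: "real \<Rightarrow> real" where
  "arcsine_density x = (if 0 < x \<and> x < 1 then 1 / (pi * sqrt (x * (1 - x))) else 0)"

lemma borel_measurable_arcsine_density [measurable]: "arcsine_density \<in> borel_measurable borel"
  unfolding arcsine_density_def[abs_def] by measurable

lemma arcsine_density_nonneg [simp]: "0 \<le> arcsine_density x"
  by (simp add: arcsine_density_def)

lemma nn_integral_Icc_reflect:
  fixes h :: "real \<Rightarrow> ennreal"
  assumes [measurable]: "h \<in> borel_measurable borel"
  shows "(\<integral>\<^sup>+x\<in>{a..b}. h (a + b - x) \<partial>lborel) = (\<integral>\<^sup>+x\<in>{a..b}. h x \<partial>lborel)"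
proof -
  have ind: "indicator {a..b} (a + b + -1 * x) = (indicator {a..b} x :: ennreal)" for x
    by (auto simp: indicator_def)
  have "(\<integral>\<^sup>+x\<in>{a..b}. h x \<partial>lborel)
    = ennreal \<bar>-1\<bar> * (\<integral>\<^sup>+x. h (a + b + -1 * x) * indicator {a..b} (a + b + -1 * x) \<partial>lborel)"
    by (rule nn_integral_real_affine) simp_all
  then show ?thesis unfolding ind by simp
qed

lemma nn_integral_Icc_symmetric:
  fixes h :: "real \<Rightarrow> ennreal"
  assumes [measurable]: "h \<in> borel_measurable borel" and sym: "\<And>x. h (2 * a - x) = h x"
    and "0 \<le> a"
  shows "(\<integral>\<^sup>+x\<in>{0..2 * a}. h x \<partial>lborel) = 2 * (\<integral>\<^sup>+x\<in>{0..a}. h x \<partial>lborel)"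
proof -
  have "(\<integral>\<^sup>+x\<in>{0..2 * a}. h x \<partial>lborel)
    = (\<integral>\<^sup>+x. h x * indicator {0..a} x + h x * indicator {a..2 * a} x \<partial>lborel)"
  proof (rule nn_integral_cong_AE)
    have "AE x in lborel. x \<noteq> a" by (rule AE_lborel_singleton)
    then show "AE x in lborel. h x * indicator {0..2 * a} x
        = h x * indicator {0..a} x + h x * indicator {a..2 * a} x"
    proof eventually_elim
      case (elim x)
      then consider "x < a" | "a < x" by linarith
      then show ?case using \<open>0 \<le> a\<close> by cases (simp_all add: indicator_def)
    qed
  qed
  also have "\<dots> = (\<integral>\<^sup>+x\<in>{0..a}. h x \<partial>lborel) + (\<integral>\<^sup>+x\<in>{a..2 * a}. h x \<partial>lborel)"
    by (rule nn_integral_add) measurable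
  also have "(\<integral>\<^sup>+x\<in>{a..2 * a}. h x \<partial>lborel) = (\<integral>\<^sup>+x\<in>{0..a}. h x \<partial>lborel)"
  proof -
    have ind: "indicator {a..2 * a} (2 * a + -1 * x) = (indicator {0..a} x :: ennreal)" for x
      by (auto simp: indicator_def)
    have "(\<integral>\<^sup>+x\<in>{a..2 * a}. h x \<partial>lborel)
      = ennreal \<bar>-1\<bar> * (\<integral>\<^sup>+x. h (2 * a + -1 * x) * indicator {a..2 * a} (2 * a + -1 * x) \<partial>lborel)"
      by (rule nn_integral_real_affine) simp_all
    then show ?thesis unfolding ind by (simp add: sym)
  qed
  also have "(\<integral>\<^sup>+x\<in>{0..a}. h x \<partial>lborel) + (\<integral>\<^sup>+x\<in>{0..a}. h x \<partial>lborel)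
      = 2 * (\<integral>\<^sup>+x\<in>{0..a}. h x \<partial>lborel)"
    by (rule mult_2[symmetric])
  finally show ?thesis .
qed

text \<open>The square of the sine of a uniform angle in \<open>{0..pi/2}\<close> has the arcsine law. With
  \<open>x = (sin \<psi>)\<^sup>2\<close> the Jacobian \<open>2 * sin \<psi> * cos \<psi>\<close> equals \<open>2 * sqrt (x * (1 - x))\<close>, which is
  \<open>2 / pi\<close> times the reciprocal of the density at \<open>x\<close>.\<close>

lemma nn_integral_sin_squared:
  fixes A :: "real set"
  assumes [measurable]: "A \<in> sets borel"
  shows "(\<integral>\<^sup>+\<psi>\<in>{0..pi/2}. indicator A ((sin \<psi>)\<^sup>2) \<partial>lborel)
    = ennreal (pi / 2) * emeasure (density lborel arcsine_density) A"
proof -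
  let ?f = "\<lambda>x. pi / 2 * arcsine_density x * indicator A x"
  \<comment> \<open>At the two endpoints the Jacobian vanishes, so the integrands agree only almost everywhere.\<close>
  have "(\<integral>\<^sup>+\<psi>\<in>{0..pi/2}. indicator A ((sin \<psi>)\<^sup>2) \<partial>lborel)
    = (\<integral>\<^sup>+\<psi>. ennreal (?f ((sin \<psi>)\<^sup>2) * (2 * sin \<psi> * cos \<psi>) * indicator {0..pi/2} \<psi>) \<partial>lborel)"
  proof (rule nn_integral_cong_AE)
    have "AE x in lborel. x \<noteq> (0::real)" "AE x in lborel. x \<noteq> pi / 2"
      by (rule AE_lborel_singleton)+
    then show "AE \<psi> in lborel. indicator A ((sin \<psi>)\<^sup>2) * indicator {0..pi/2} \<psi>
      = ennreal (?f ((sin \<psi>)\<^sup>2) * (2 * sin \<psi> * cos \<psi>) * indicator {0..pi/2} \<psi>)"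
    proof eventually_elim
      case (elim \<psi>)
      show ?case
      proof (cases "0 < \<psi> \<and> \<psi> < pi / 2")
        case True
        then have pos: "0 < sin \<psi>" "0 < cos \<psi>" using sin_gt_zero[of \<psi>] cos_gt_zero[of \<psi>] by auto
        have sq: "1 - (sin \<psi>)\<^sup>2 = (cos \<psi>)\<^sup>2" by (simp add: cos_squared_eq)
        have "(sin \<psi>)\<^sup>2 < 1" using sq pos by (smt (verit) zero_less_power)
        then have "arcsine_density ((sin \<psi>)\<^sup>2) = 1 / (pi * (sin \<psi> * cos \<psi>))"
          using pos by (simp add: arcsine_density_def sq real_sqrt_mult)
        then show ?thesis using pos True by (simp add: indicator_def)
      qed (use elim in \<open>simp add: indicator_def; linarith\<close>)
    qed
  qed
  also have "\<dots> = (\<integral>\<^sup>+x. ennreal (?f x * indicator {(sin 0)\<^sup>2..(sin (pi/2))\<^sup>2} x) \<partial>lborel)"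
  proof (rule nn_integral_substitution[symmetric])
    show "set_borel_measurable borel {(sin 0)\<^sup>2..(sin (pi/2))\<^sup>2} ?f"
      unfolding set_borel_measurable_def by measurable
    show "((\<lambda>x. (sin x)\<^sup>2) has_real_derivative 2 * sin x * cos x) (at x)" for x :: real
      by (auto intro!: derivative_eq_intros)
    show "continuous_on {0..pi/2} (\<lambda>x. 2 * sin x * cos x)" by (intro continuous_intros)
    show "0 \<le> 2 * sin x * cos x" if "x \<in> {0..pi/2}" for x
      using that sin_ge_zero[of x] cos_ge_zero[of x] by simp
  qed simp
  also have "\<dots> = (\<integral>\<^sup>+x. ennreal (pi / 2) * (ennreal (arcsine_density x) * indicator A x) \<partial>lborel)"
  proof (rule nn_integral_cong)
    fix x :: real
    have "?f x * indicator {(sin 0)\<^sup>2..(sin (pi/2))\<^sup>2} x = pi / 2 * (arcsine_density x * indicator A x)"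
      by (auto simp: arcsine_density_def indicator_def)
    then show "ennreal (?f x * indicator {(sin 0)\<^sup>2..(sin (pi/2))\<^sup>2} x)
        = ennreal (pi / 2) * (ennreal (arcsine_density x) * indicator A x)"
      by (simp only: ennreal_mult' ennreal_indicator arcsine_density_nonneg pi_half_ge_zero)
  qed
  also have "\<dots> = ennreal (pi / 2) * emeasure (density lborel arcsine_density) A"
    by (simp add: nn_integral_cmult emeasure_density)
  finally show ?thesis .
qed

lemma nn_integral_circle_arclength:
  fixes h :: "complex \<Rightarrow> ennreal"
  assumes [measurable]: "h \<in> borel_measurable borel"
  shows "(\<integral>\<^sup>+z. h z \<partial>circle_arclength) = (\<integral>\<^sup>+\<theta>\<in>{0..2 * pi}. h (cis \<theta>) \<partial>lborel)"
proof -
  have cis[measurable]: "cis \<in> borel_measurable borel"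
    by (intro borel_measurable_continuous_onI continuous_intros)
  have "(\<integral>\<^sup>+z. h z \<partial>circle_arclength) = (\<integral>\<^sup>+\<theta>. h (cis \<theta>) \<partial>restrict_space lborel {0..<2 * pi})"
    unfolding circle_arclength_def
    by (rule nn_integral_distr) (auto intro!: measurable_restrict_space1)
  also have "\<dots> = (\<integral>\<^sup>+\<theta>\<in>{0..<2 * pi}. h (cis \<theta>) \<partial>lborel)"
    by (rule nn_integral_restrict_space) simp
  also have "\<dots> = (\<integral>\<^sup>+\<theta>\<in>{0..2 * pi}. h (cis \<theta>) \<partial>lborel)"
  proof (rule nn_integral_cong_AE)
    have "AE \<theta> in lborel. \<theta> \<noteq> 2 * pi" by (rule AE_lborel_singleton)
    then show "AE \<theta> in lborel. h (cis \<theta>) * indicator {0..<2 * pi} \<theta>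
        = h (cis \<theta>) * indicator {0..2 * pi} \<theta>"
      by eventually_elim (simp add: indicator_def less_le)
  qed
  finally show ?thesis .
qed

text \<open>The squared cosine takes its values equally often in each of the four quadrants, and on the
  first one it is the mirror image of the squared sine.\<close>

lemma nn_integral_uniform_circle_Re_squared:
  fixes A :: "real set"
  assumes [measurable]: "A \<in> sets borel"
  shows "(\<integral>\<^sup>+z. indicator A ((Re z)\<^sup>2) \<partial>uniform_measure circle_arclength (sphere 0 1))
    = emeasure (density lborel arcsine_density) A"
proof -
  let ?E = "emeasure (density lborel arcsine_density) A"
  let ?h = "\<lambda>\<theta>. indicator A ((cos \<theta>)\<^sup>2) :: ennreal"
  have sets[measurable_cong]: "sets circle_arclength = sets borel"
    by (simp add: circle_arclength_def)
  have [measurable]: "sphere (0::complex) 1 \<in> sets borel" by simp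
  \<comment> \<open>Reflections in \<open>pi\<close> and in \<open>pi / 2\<close> reduce the full circle to one quadrant.\<close>
  have "cos (2 * pi - x) = cos x" "cos (2 * (pi / 2) - x) = - cos x" for x
    by (simp_all add: cos_diff)
  then have h: "(\<integral>\<^sup>+\<theta>\<in>{0..2 * pi}. ?h \<theta> \<partial>lborel) = 2 * (\<integral>\<^sup>+\<theta>\<in>{0..pi}. ?h \<theta> \<partial>lborel)"
      "(\<integral>\<^sup>+\<theta>\<in>{0..2 * (pi / 2)}. ?h \<theta> \<partial>lborel) = 2 * (\<integral>\<^sup>+\<theta>\<in>{0..pi / 2}. ?h \<theta> \<partial>lborel)"
    by (intro nn_integral_Icc_symmetric; simp)+
  have "(\<integral>\<^sup>+\<theta>\<in>{0..pi/2}. ?h \<theta> \<partial>lborel)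
      = (\<integral>\<^sup>+\<theta>\<in>{0..pi/2}. ?h (0 + pi / 2 - \<theta>) \<partial>lborel)"
    by (rule nn_integral_Icc_reflect[symmetric]) measurable
  also have "\<dots> = (\<integral>\<^sup>+\<theta>\<in>{0..pi/2}. indicator A ((sin \<theta>)\<^sup>2) \<partial>lborel)"
    by (simp add: cos_diff)
  also have "\<dots> = ennreal (pi / 2) * ?E"
    by (rule nn_integral_sin_squared) measurable
  finally have "(\<integral>\<^sup>+\<theta>\<in>{0..2 * pi}. ?h \<theta> \<partial>lborel) = 2 * (2 * (ennreal (pi / 2) * ?E))"
    using h by simp
  also have "\<dots> = ennreal (2 * pi) * ?E"
    by (simp add: mult.assoc[symmetric] flip: ennreal_numeral ennreal_mult'')
  finally have quarters: "(\<integral>\<^sup>+\<theta>\<in>{0..2 * pi}. ?h \<theta> \<partial>lborel) = ennreal (2 * pi) * ?E" .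
  have "emeasure circle_arclength (sphere 0 1)
      = (\<integral>\<^sup>+\<theta>\<in>{0..2 * pi}. indicator (sphere 0 1) (cis \<theta>) \<partial>lborel)"
    by (subst nn_integral_circle_arclength[symmetric]) (simp_all add: sets)
  also have "\<dots> = (\<integral>\<^sup>+\<theta>. indicator {0..2 * pi} \<theta> \<partial>lborel)"
    by simp
  also have "\<dots> = ennreal (2 * pi)"
    by simp
  finally have total: "emeasure circle_arclength (sphere 0 1) = ennreal (2 * pi)" .
  have "(\<integral>\<^sup>+z. indicator A ((Re z)\<^sup>2) \<partial>uniform_measure circle_arclength (sphere 0 1))
      = (\<integral>\<^sup>+z. indicator A ((Re z)\<^sup>2) * indicator (sphere 0 1) z \<partial>circle_arclength) / ennreal (2 * pi)"
    by (subst nn_integral_uniform_measure) (simp_all add: total sets)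
  also have "(\<integral>\<^sup>+z. indicator A ((Re z)\<^sup>2) * indicator (sphere 0 1) z \<partial>circle_arclength)
      = ennreal (2 * pi) * ?E"
    unfolding quarters[symmetric]
    by (subst nn_integral_circle_arclength) simp_all
  also have "ennreal (2 * pi) * ?E / ennreal (2 * pi) = ?E"
    by (subst mult.commute, rule ennreal_mult_divide_eq) simp_all
  finally show ?thesis .
qed

lemma nn_integral_uniform_sin_half_squared:
  fixes A :: "real set"
  assumes [measurable]: "A \<in> sets borel"
  shows "(\<integral>\<^sup>+\<phi>. indicator A ((sin (\<phi> / 2))\<^sup>2) \<partial>uniform_measure lborel {0..pi})
    = emeasure (density lborel arcsine_density) A"
proof -
  let ?E = "emeasure (density lborel arcsine_density) A"
  have ind: "indicator {0..pi} (0 + 2 * x) = (indicator {0..pi / 2} x :: ennreal)" for x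
    by (auto simp: indicator_def)
  have "(\<integral>\<^sup>+\<phi>\<in>{0..pi}. indicator A ((sin (\<phi> / 2))\<^sup>2) \<partial>lborel)
    = ennreal \<bar>2\<bar> * (\<integral>\<^sup>+x. indicator A ((sin ((0 + 2 * x) / 2))\<^sup>2) * indicator {0..pi} (0 + 2 * x) \<partial>lborel)"
    by (rule nn_integral_real_affine) simp_all
  also have "\<dots> = 2 * (\<integral>\<^sup>+x\<in>{0..pi/2}. indicator A ((sin x)\<^sup>2) \<partial>lborel)"
    unfolding ind by simp
  also have "\<dots> = 2 * (ennreal (pi / 2) * ?E)"
    by (subst nn_integral_sin_squared) simp_all
  also have "\<dots> = ennreal pi * ?E"
    by (simp add: mult.assoc[symmetric] flip: ennreal_numeral ennreal_mult'')
  finally have "(\<integral>\<^sup>+\<phi>\<in>{0..pi}. indicator A ((sin (\<phi> / 2))\<^sup>2) \<partial>lborel) = ennreal pi * ?E" .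
  then have "(\<integral>\<^sup>+\<phi>. indicator A ((sin (\<phi> / 2))\<^sup>2) \<partial>uniform_measure lborel {0..pi})
      = ennreal pi * ?E / ennreal pi"
    by (subst nn_integral_uniform_measure) simp_all
  also have "\<dots> = ?E"
    by (subst mult.commute, rule ennreal_mult_divide_eq) simp_all
  finally show ?thesis .
qed

section \<open>The quotient of two arcsine variables\<close>

text \<open>The density at \<open>w\<close> of the quotient of two independent arcsine variables. The integrand is
  \<open>1 / (pi\<^sup>2 * sqrt w * sqrt (1 - v) * sqrt (1 - w * v))\<close> where both densities are nonzero, that is
  between \<open>0\<close> and \<open>min 1 (1 / w)\<close>. It has an elementary antiderivative, which stays continuous at
  the upper end although the integrand blows up there, so the fundamental theorem applies. At
  \<open>w = 1\<close> the two singularities merge and the integral diverges.\<close>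

lemma nn_integral_arcsine_quotient:
  assumes w: "0 < w" "w \<noteq> 1"
  shows "(\<integral>\<^sup>+v. ennreal \<bar>v\<bar> * ennreal (arcsine_density (w * v)) * ennreal (arcsine_density v) \<partial>lborel)
    = ennreal (1 / (pi\<^sup>2 * w) * ln \<bar>(1 + sqrt w) / (1 - sqrt w)\<bar>)"
proof -
  define m where "m = min 1 (1 / w)"
  define g where "g v = sqrt w * sqrt (1 - v) + sqrt (1 - w * v)" for v
  define F where "F v = - (2 / (pi\<^sup>2 * w)) * ln (g v)" for v
  define h where "h v = \<bar>v\<bar> * arcsine_density (w * v) * arcsine_density v" for v
  have m: "0 < m" using w by (simp add: m_def)
  \<comment> \<open>\<open>m\<close> is where the first of the two square roots in \<open>g\<close> reaches \<open>0\<close>; the other one is still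
    positive there because \<open>w \<noteq> 1\<close>.\<close>
  have le_m: "v \<le> m \<longleftrightarrow> v \<le> 1 \<and> w * v \<le> 1" and less_m: "v < m \<longleftrightarrow> v < 1 \<and> w * v < 1" for v
    using w by (simp_all add: m_def field_simps)
  have g_pos: "0 < g v" if "v \<le> m" for v
  proof -
    have "v < 1 \<or> w * v < 1"
      using that w by (cases "v = 1") (auto simp: le_m less_le)
    then show ?thesis
      using that w by (auto simp: g_def le_m intro: add_pos_nonneg add_nonneg_pos)
  qed
  have h_eq: "h v = 1 / (pi\<^sup>2 * sqrt w * sqrt (1 - v) * sqrt (1 - w * v))" if "0 < v" "v < m" for v
  proof -
    have v: "v < 1" "0 < w * v" "w * v < 1" using that w by (auto simp: less_m)
    then have "h v = v / ((pi * sqrt (w * v * (1 - w * v))) * (pi * sqrt (v * (1 - v))))"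
      using that by (simp add: h_def arcsine_density_def)
    also have "(pi * sqrt (w * v * (1 - w * v))) * (pi * sqrt (v * (1 - v)))
        = v * (pi\<^sup>2 * sqrt w * sqrt (1 - v) * sqrt (1 - w * v))"
      using that by (simp add: real_sqrt_mult power2_eq_square)
    finally show ?thesis using that by simp
  qed
  have h_zero: "h v = 0" if "v \<notin> {0..m}" for v
    using that le_m[of v] by (auto simp: h_def arcsine_density_def)
  have "(h has_integral (F m - F 0)) {0..m}"
  proof (rule fundamental_theorem_of_calculus_interior)
    show "0 \<le> m" using m by simp
    have "continuous_on {0..m} g"
      unfolding g_def by (intro continuous_intros)
    moreover have "g v \<noteq> 0" if "v \<in> {0..m}" for v
      using g_pos[of v] that by simp
    ultimately show "continuous_on {0..m} F"
      unfolding F_def by (intro continuous_intros) auto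
    fix v assume "v \<in> {0<..<m}"
    then have v: "0 < v" "v < m" by auto
    define s t where "s = sqrt (1 - v)" and "t = sqrt (1 - w * v)"
    have st: "0 < s" "0 < t" using v by (auto simp: s_def t_def less_m)
    have "(g has_real_derivative sqrt w * (- 1 / (2 * s)) - w / (2 * t)) (at v)"
      unfolding g_def s_def t_def using v
      by (auto intro!: derivative_eq_intros simp: less_m field_simps)
    then have "(F has_real_derivative
        - (2 / (pi\<^sup>2 * w)) * ((sqrt w * (- 1 / (2 * s)) - w / (2 * t)) / g v)) (at v)"
      unfolding F_def using g_pos[of v] v w by (auto intro!: derivative_eq_intros)
    moreover have "- (2 / (pi\<^sup>2 * w)) * ((sqrt w * (- 1 / (2 * s)) - w / (2 * t)) / g v) = h v"
    proof -
      have g: "g v = sqrt w * s + t" by (simp add: g_def s_def t_def)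
      have "sqrt w * (- 1 / (2 * s)) - w / (2 * t) = - (sqrt w * t + sqrt w * sqrt w * s) / (2 * s * t)"
        using st w by (simp add: field_simps)
      also have "\<dots> = - sqrt w * g v / (2 * s * t)"
        by (simp add: g algebra_simps)
      finally have "- (2 / (pi\<^sup>2 * w)) * ((sqrt w * (- 1 / (2 * s)) - w / (2 * t)) / g v)
          = sqrt w / (pi\<^sup>2 * w * s * t)"
        using g_pos[of v] v by simp
      also have "\<dots> = 1 / (pi\<^sup>2 * sqrt w * s * t)"
      proof -
        define r where "r = sqrt w"
        have "0 < r" "w = r * r" using w by (simp_all add: r_def)
        then show ?thesis unfolding r_def[symmetric] by simp
      qed
      also have "\<dots> = h v"
        using h_eq[OF v] by (simp only: s_def t_def)
      finally show ?thesis .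
    qed
    ultimately show "(F has_vector_derivative h v) (at v)"
      by (simp add: has_real_derivative_iff_has_vector_derivative)
  qed
  moreover have "0 \<le> h v" for v by (simp add: h_def)
  ultimately have "(\<integral>\<^sup>+v. ennreal (h v) * indicator {0..m} v \<partial>lborel) = ennreal (F m - F 0)"
    by (intro nn_integral_has_integral_lebesgue')
  moreover have "ennreal \<bar>v\<bar> * ennreal (arcsine_density (w * v)) * ennreal (arcsine_density v)
      = ennreal (h v) * indicator {0..m} v" for v
    using h_zero[of v] by (auto simp: h_def ennreal_mult[symmetric] indicator_def)
  moreover have "F m - F 0 = 1 / (pi\<^sup>2 * w) * ln \<bar>(1 + sqrt w) / (1 - sqrt w)\<bar>"
  proof -
    \<comment> \<open>This value covers both \<open>w < 1\<close> and \<open>w > 1\<close>, so the absolute value in the logarithm comes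
      from here.\<close>
    have gm: "g m = sqrt \<bar>1 - w\<bar>"
    proof (cases "w < 1")
      case True
      then have "m = 1" using w by (simp add: m_def)
      then show ?thesis using True by (simp add: g_def)
    next
      case False
      then have "m = 1 / w" using w by (simp add: m_def)
      then have "g m = sqrt (w * (1 - 1 / w))" using w by (simp add: g_def real_sqrt_mult)
      also have "w * (1 - 1 / w) = \<bar>1 - w\<bar>" using w False by (simp add: field_simps)
      finally show ?thesis .
    qed
    have root: "sqrt w \<noteq> 1" "0 < 1 + sqrt w" using w by (auto intro: add_pos_pos)
    have "\<bar>1 - w\<bar> = \<bar>(1 + sqrt w) * (1 - sqrt w)\<bar>"
      using w by (simp add: algebra_simps)
    then have "\<bar>1 - w\<bar> = (1 + sqrt w) * \<bar>1 - sqrt w\<bar>"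
      using root by (simp add: abs_mult)
    then have "ln \<bar>1 - w\<bar> = ln (1 + sqrt w) + ln \<bar>1 - sqrt w\<bar>"
      using root by (simp add: ln_mult_pos)
    moreover have "2 * ln (g m) = ln \<bar>1 - w\<bar>"
      using w by (simp add: gm ln_sqrt)
    moreover have "ln \<bar>(1 + sqrt w) / (1 - sqrt w)\<bar> = ln (1 + sqrt w) - ln \<bar>1 - sqrt w\<bar>"
      using root by (simp add: ln_div)
    ultimately have "2 * ln (1 + sqrt w) - 2 * ln (g m) = ln \<bar>(1 + sqrt w) / (1 - sqrt w)\<bar>"
      by linarith
    moreover have "F m - F 0 = 1 / (pi\<^sup>2 * w) * (2 * ln (1 + sqrt w) - 2 * ln (g m))"
      by (simp add: F_def g_def[of 0] algebra_simps)
    ultimately show ?thesis by simp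
  qed
  ultimately show ?thesis by simp
qed

section \<open>The law of \<open>beta\<close>\<close>

lemma beta_disk_elem:
  assumes "(norm a)\<^sup>2 - (norm c)\<^sup>2 = 1"
  shows "beta (disk_elem a c) = complex_of_real ((2 * Re a)\<^sup>2 - 4)"
proof -
  have "disk_elem a c \<in> carrier PSL2C"
    using assms subgroup.subset[OF subgroup_disk_group] by (auto simp: disk_group_def)
  then have "beta (disk_elem a c) = (trace (disk_matrix a c))\<^sup>2 - 4"
    by (rule beta_eq) (simp add: disk_elem_eq)
  also have "trace (disk_matrix a c) = complex_of_real (2 * Re a)"
    by (simp add: disk_matrix_def trace_def sum_2 complex_eq_iff)
  finally show ?thesis by simp
qed

text \<open>The density of \<open>-4 + 4 * W\<close> in closed form, for \<open>W\<close> the quotient of two independent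
  arcsine variables: by the quotient lemma at \<open>w = (b + 4) / 4\<close>, with \<open>sqrt w = sqrt (b + 4) / 2\<close>.
  For \<open>b < -4\<close> the quotient would be negative, so the integrand vanishes identically. The two
  excluded points are the values of \<open>-4 + 4 * w\<close> at \<open>w = 0\<close> and \<open>w = 1\<close>.\<close>

lemma beta_density_rescaled:
  assumes "b \<noteq> -4" "b \<noteq> 0"
  shows "(\<integral>\<^sup>+v. ennreal \<bar>v\<bar> * ennreal (arcsine_density ((b - (-4)) / 4 * v)) * ennreal (arcsine_density v) \<partial>lborel)
      / ennreal \<bar>4\<bar>
    = ennreal (if b \<ge> -4
        then 1 / (pi\<^sup>2 * (b + 4)) * ln \<bar>(sqrt (b + 4) + 2) / (sqrt (b + 4) - 2)\<bar> else 0)"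
proof (cases "-4 < b")
  case True
  define s where "s = sqrt (b + 4)"
  let ?w = "(b - (-4)) / 4"
  have root: "sqrt ?w = s / 2" by (simp add: s_def real_sqrt_divide)
  have "\<bar>(1 + s / 2) / (1 - s / 2)\<bar> = \<bar>(s + 2) / (s - 2)\<bar>"
  proof -
    have "1 + s / 2 = (s + 2) / 2" "1 - s / 2 = (2 - s) / 2" by simp_all
    then have "(1 + s / 2) / (1 - s / 2) = (s + 2) / (2 - s)"
      by (simp only: divide_divide_eq_left divide_divide_eq_right)
    then show ?thesis by (simp add: abs_divide abs_minus_commute)
  qed
  then have "(\<integral>\<^sup>+v. ennreal \<bar>v\<bar> * ennreal (arcsine_density (?w * v)) * ennreal (arcsine_density v) \<partial>lborel)
      = ennreal (1 / (pi\<^sup>2 * ?w) * ln \<bar>(s + 2) / (s - 2)\<bar>)"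
    using nn_integral_arcsine_quotient[of ?w] True assms by (simp only: root) simp
  also have "\<dots> / ennreal \<bar>4\<bar> = ennreal (1 / (pi\<^sup>2 * ?w) * ln \<bar>(s + 2) / (s - 2)\<bar> * (1 / 4))"
  proof -
    have "inverse (ennreal \<bar>4\<bar>) = ennreal (1 / 4)"
      by (subst inverse_ennreal) (simp_all add: inverse_eq_divide)
    then have "ennreal x / ennreal \<bar>4\<bar> = ennreal (x * (1 / 4))" for x
      unfolding divide_ennreal_def by (simp only: ennreal_mult'')
    then show ?thesis .
  qed
  also have "1 / (pi\<^sup>2 * ?w) * ln \<bar>(s + 2) / (s - 2)\<bar> * (1 / 4) = 1 / (pi\<^sup>2 * (b + 4)) * ln \<bar>(s + 2) / (s - 2)\<bar>"
    by simp
  finally show ?thesis using True by (simp add: s_def)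
next
  case False
  then have "(b - (-4)) / 4 * v < 0" if "0 < v" for v
    using that assms by (simp add: mult_neg_pos)
  then have "arcsine_density ((b - (-4)) / 4 * v) = 0 \<or> arcsine_density v = 0" for v
    unfolding arcsine_density_def by (smt (verit))
  then have "ennreal \<bar>v\<bar> * ennreal (arcsine_density ((b - (-4)) / 4 * v)) * ennreal (arcsine_density v) = 0" for v
    by (metis ennreal_0 mult_zero_right mult_zero_left)
  then have "(\<integral>\<^sup>+v. ennreal \<bar>v\<bar> * ennreal (arcsine_density ((b - (-4)) / 4 * v)) * ennreal (arcsine_density v) \<partial>lborel) = 0"
    by (simp only: nn_integral_const mult_zero_left)
  then show ?thesis using False by (simp only: ennreal_zero_divide) simp
qed

theorem theorem5p8:
  fixes M :: "'w measure" and f :: "'w \<Rightarrow> (complex^2^2) set"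
  assumes "prob_space M" and "random_disk_element M f"
  shows "(\<forall>\<omega>\<in>space M. beta (f \<omega>) \<in> complex_of_real ` {-4..}) \<and>
    distributed M lborel (\<lambda>\<omega>. Re (beta (f \<omega>)))
      (\<lambda>b. ennreal (if b \<ge> -4
         then 1 / (pi\<^sup>2 * (b + 4)) * ln \<bar>(sqrt (b + 4) + 2) / (sqrt (b + 4) - 2)\<bar>
         else 0))"
proof -
  interpret prob_space M by fact
  obtain a c where [measurable]: "a \<in> borel_measurable M" "c \<in> borel_measurable M"
    and elem: "\<And>\<omega>. \<omega> \<in> space M \<Longrightarrow> (norm (a \<omega>))\<^sup>2 - (norm (c \<omega>))\<^sup>2 = 1 \<and> f \<omega> = disk_elem (a \<omega>) (c \<omega>)"
    and indep: "indep_vars (\<lambda>_. borel)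
      (\<lambda>i \<omega>. [sgn (a \<omega>), sgn (c \<omega>), complex_of_real (norm (a \<omega>))] ! i) {0, 1, 2}"
    and dir: "distr M borel (\<lambda>\<omega>. sgn (a \<omega>)) = uniform_measure circle_arclength (sphere 0 1)"
    and len: "distr M borel (\<lambda>\<omega>. 2 * arcsin (1 / norm (a \<omega>))) = uniform_measure lborel {0..pi}"
    using assms(2) unfolding random_disk_element_def by blast
  have beta: "beta (f \<omega>) = complex_of_real ((2 * Re (a \<omega>))\<^sup>2 - 4)" if "\<omega> \<in> space M" for \<omega>
    using elem[OF that] by (simp add: beta_disk_elem)
  have norm_a: "1 \<le> norm (a \<omega>)" if "\<omega> \<in> space M" for \<omega>
  proof -
    have "1\<^sup>2 \<le> (norm (a \<omega>))\<^sup>2" using elem[OF that] by (smt (verit) one_power2 zero_le_power2)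
    then show ?thesis by (rule power2_le_imp_le) simp
  qed
  have inv_norm_a: "1 / norm (a \<omega>) \<in> {-1..1}" if "\<omega> \<in> space M" for \<omega>
  proof -
    have "0 < norm (a \<omega>)" using norm_a[OF that] by linarith
    then have "1 / norm (a \<omega>) \<le> 1"
      using norm_a[OF that] by (simp only: divide_le_eq_1_pos)
    moreover have "- 1 \<le> (0::real)" "0 \<le> 1 / norm (a \<omega>)" by simp_all
    ultimately show ?thesis unfolding atLeastAtMost_iff by linarith
  qed
  \<comment> \<open>\<open>U\<close> depends only on the direction of \<open>a\<close> and \<open>V\<close> only on its length, and
    \<open>(Re a)\<^sup>2 = U / V\<close>.\<close>
  define U where "U \<omega> = (Re (sgn (a \<omega>)))\<^sup>2" for \<omega>
  define V where "V \<omega> = (1 / norm (a \<omega>))\<^sup>2" for \<omega>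
  have [measurable]: "U \<in> borel_measurable M" "V \<in> borel_measurable M"
    unfolding U_def[abs_def] V_def[abs_def] sgn_div_norm by measurable
  have [measurable]: "(\<lambda>\<omega>. sgn (a \<omega>)) \<in> borel_measurable M"
    unfolding sgn_div_norm by measurable
  have "distributed M lborel U arcsine_density"
  proof (rule distributed_lborelI)
    fix A :: "real set" assume [measurable]: "A \<in> sets borel"
    have "(\<integral>\<^sup>+\<omega>. indicator A (U \<omega>) \<partial>M)
      = (\<integral>\<^sup>+z. indicator A ((Re z)\<^sup>2) \<partial>distr M borel (\<lambda>\<omega>. sgn (a \<omega>)))"
      unfolding U_def by (rule nn_integral_distr[symmetric]) measurable
    then show "(\<integral>\<^sup>+\<omega>. indicator A (U \<omega>) \<partial>M) = emeasure (density lborel arcsine_density) A"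
      by (simp add: dir nn_integral_uniform_circle_Re_squared)
  qed measurable
  moreover have "distributed M lborel V arcsine_density"
  proof (rule distributed_lborelI)
    fix A :: "real set" assume [measurable]: "A \<in> sets borel"
    \<comment> \<open>\<open>arcsin\<close> is specified only on \<open>{-1..1}\<close>, where it is continuous; \<open>1 / norm (a \<omega>)\<close> stays
      inside because \<open>1 \<le> norm (a \<omega>)\<close>.\<close>
    have [measurable]: "(\<lambda>x. indicator {-1..1} x *\<^sub>R arcsin x) \<in> borel_measurable borel"
      by (rule borel_measurable_continuous_on_indicator) (auto intro: continuous_on_arcsin')
    have "(\<lambda>\<omega>. 2 * (indicator {-1..1} (1 / norm (a \<omega>)) *\<^sub>R arcsin (1 / norm (a \<omega>)))) \<in> borel_measurable M"
      by measurable
    also have "?this \<longleftrightarrow> (\<lambda>\<omega>. 2 * arcsin (1 / norm (a \<omega>))) \<in> borel_measurable M"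
      by (rule measurable_cong) (use inv_norm_a in simp)
    finally have [measurable]: "(\<lambda>\<omega>. 2 * arcsin (1 / norm (a \<omega>))) \<in> borel_measurable M" .
    have "(\<integral>\<^sup>+\<omega>. indicator A (V \<omega>) \<partial>M)
      = (\<integral>\<^sup>+\<omega>. indicator A ((sin (2 * arcsin (1 / norm (a \<omega>)) / 2))\<^sup>2) \<partial>M)"
    proof (rule nn_integral_cong)
      fix \<omega> assume "\<omega> \<in> space M"
      then have "sin (arcsin (1 / norm (a \<omega>))) = 1 / norm (a \<omega>)"
        using inv_norm_a[of \<omega>] by (intro sin_arcsin) simp_all
      then show "indicator A (V \<omega>) = (indicator A ((sin (2 * arcsin (1 / norm (a \<omega>)) / 2))\<^sup>2) :: ennreal)"
        by (simp add: V_def)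
    qed
    also have "\<dots> = (\<integral>\<^sup>+\<phi>. indicator A ((sin (\<phi> / 2))\<^sup>2)
        \<partial>distr M borel (\<lambda>\<omega>. 2 * arcsin (1 / norm (a \<omega>))))"
      by (rule nn_integral_distr[symmetric]) measurable
    finally show "(\<integral>\<^sup>+\<omega>. indicator A (V \<omega>) \<partial>M) = emeasure (density lborel arcsine_density) A"
      by (simp add: len nn_integral_uniform_sin_half_squared)
  qed measurable
  moreover have "indep_var borel U borel V"
  proof -
    have "indep_var borel ((\<lambda>x. (Re (x 0))\<^sup>2) \<circ>
        (\<lambda>\<omega>. \<lambda>i\<in>{0}. [sgn (a \<omega>), sgn (c \<omega>), complex_of_real (norm (a \<omega>))] ! i))
      borel ((\<lambda>x. (1 / norm (x 2))\<^sup>2) \<circ>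
        (\<lambda>\<omega>. \<lambda>i\<in>{2}. [sgn (a \<omega>), sgn (c \<omega>), complex_of_real (norm (a \<omega>))] ! i))"
      by (rule indep_var_compose[OF indep_var_restrict[OF indep]]) (simp_all, measurable)
    then show ?thesis
      by (simp add: comp_def U_def[abs_def] V_def[abs_def])
  qed
  ultimately have "distributed M lborel (\<lambda>\<omega>. U \<omega> / V \<omega>)
      (\<lambda>w. \<integral>\<^sup>+v. ennreal \<bar>v\<bar> * ennreal (arcsine_density (w * v)) * ennreal (arcsine_density v) \<partial>lborel)"
    by (intro distributed_divide)
  then have affine: "distributed M lborel (\<lambda>\<omega>. -4 + 4 * (U \<omega> / V \<omega>))
      (\<lambda>b. (\<integral>\<^sup>+v. ennreal \<bar>v\<bar> * ennreal (arcsine_density ((b - (-4)) / 4 * v))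
          * ennreal (arcsine_density v) \<partial>lborel) / ennreal \<bar>4\<bar>)"
    by (rule distributed_affine) simp
  have dist: "distributed M lborel (\<lambda>\<omega>. -4 + 4 * (U \<omega> / V \<omega>))
      (\<lambda>b. ennreal (if b \<ge> -4
         then 1 / (pi\<^sup>2 * (b + 4)) * ln \<bar>(sqrt (b + 4) + 2) / (sqrt (b + 4) - 2)\<bar> else 0))"
    (is "distributed M lborel _ ?G")
  proof -
    have "AE b in lborel. b \<noteq> (-4 :: real)" "AE b in lborel. b \<noteq> (0 :: real)"
      by (rule AE_lborel_singleton)+
    then have "AE b in lborel. (\<integral>\<^sup>+v. ennreal \<bar>v\<bar> * ennreal (arcsine_density ((b - (-4)) / 4 * v))
        * ennreal (arcsine_density v) \<partial>lborel) / ennreal \<bar>4\<bar> = ?G b"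
      by eventually_elim (rule beta_density_rescaled)
    moreover have "?G \<in> borel_measurable lborel" by measurable
    ultimately show ?thesis
      by (rule distributed_cong_density[THEN iffD1, OF _ _ distributed_borel_measurable[OF affine] affine])
  qed
  have "-4 + 4 * (U \<omega> / V \<omega>) = Re (beta (f \<omega>))" if "\<omega> \<in> space M" for \<omega>
  proof -
    have "norm (a \<omega>) \<noteq> 0" using norm_a[OF that] by linarith
    then have "U \<omega> / V \<omega> = (Re (a \<omega>))\<^sup>2"
      by (simp add: U_def V_def sgn_div_norm power_divide power_mult_distrib field_simps)
    then show ?thesis by (simp add: beta[OF that] power_mult_distrib)
  qed
  then have "distributed M lborel (\<lambda>\<omega>. Re (beta (f \<omega>)))
      (\<lambda>b. ennreal (if b \<ge> -4
         then 1 / (pi\<^sup>2 * (b + 4)) * ln \<bar>(sqrt (b + 4) + 2) / (sqrt (b + 4) - 2)\<bar> else 0))"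
    using dist unfolding distributed_def
    by (simp cong: distr_cong measurable_cong_simp)
  moreover have "beta (f \<omega>) \<in> complex_of_real ` {-4..}" if "\<omega> \<in> space M" for \<omega>
    unfolding beta[OF that] by (intro imageI) simp
  ultimately show ?thesis by blast
qed

end
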